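(* For every integer $n\ge 0$ let $$F_n(q)=\sum_{k=0}^{n}\frac{(q^{n-k+1};q)_{2k}}{(q^2;q^2)_k}\,q^{\binom{n-k}{2}}.$$ Then for every $n\ge 2$, $$F_n(q)+(q^{2n-1}-1)F_{n-1}(q)-q^{2n-3}F_{n-2}(q)=0.$$
   Context: Here $q$ is an indeterminate, and $(a;q)_m=(1-a)(1-aq)\cdots(1-aq^{m-1})$ is the $q$-shifted factorial, with $(a;q)_0=1$; thus $(q^2;q^2)_k=\prod_{i=1}^{k}(1-q^{2i})$ and $(q^{n-k+1};q)_{2k}=\prod_{i=n-k+1}^{n+k}(1-q^{i})$. The identity is one of rational functions (equivalently formal power series) in $q$. *)

theory Defs
  imports "HOL-Computational_Algebra.Computational_Algebra"
begin

definition qfact :: "'a::comm_ring_1 \<Rightarrow> 'a \<Rightarrow> nat \<Rightarrow> 'a" where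
  "qfact a q m = (\<Prod>i<m. 1 - a * q ^ i)"

text \<open>The indeterminate of the field of rational functions over an arbitrary field.\<close>

definition qvar :: "'a::field poly fract" where
  "qvar = to_fract [:0, 1:]"

text \<open>In the sum, \<open>k \<le> n\<close>, so the natural-number subtraction \<open>n - k\<close> does not truncate.
  The denominators \<open>(q\<^sup>2;q\<^sup>2)\<^sub>k\<close> are nonzero because the variable is transcendental.\<close>

definition F :: "nat \<Rightarrow> 'a::field poly fract" where
  "F n = (\<Sum>k = 0..n. qfact (qvar ^ (n - k + 1)) qvar (2 * k) / qfact (qvar ^ 2) (qvar ^ 2) k
                        * qvar ^ ((n - k) choose 2))"

end

theory Submission imports Defs begin

text \<open>Let $t(n,k)$ be the summand of $F_n$, which vanishes for $k > n$. Applying q-Zeilberger gives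
  a certificate so simple that the recurrence already holds term by term after a shift of $k$ in
  the middle summand:
  $t(n+2,k+1) = q^{2n+1} t(n,k+1) + (1 - q^{2n+3}) t(n+1,k)$ and $t(n+2,0) = q^{2n+1} t(n,0)$.\<close>

lemma qfact_0 [simp]: "qfact a q 0 = 1"
  by (simp add: qfact_def)

lemma qfact_Suc: "qfact a q (Suc m) = qfact a q m * (1 - a * q ^ m)"
  by (simp add: qfact_def)

lemma qfact_Suc_shift: "qfact a q (Suc m) = (1 - a) * qfact (a * q) q m"
  by (simp add: qfact_def prod.lessThan_Suc_shift ac_simps del: prod.lessThan_Suc)

text \<open>The variable is an arbitrary field element, so the recurrence reduces to algebra plus a
  condition on powers of \<open>q\<close>. For \<open>k > n\<close> the subtraction
  \<open>n - k\<close> truncates to 0, so the value need not vanish there, unlike the mathematical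
  summand.\<close>

definition qsummand :: "'a::field \<Rightarrow> nat \<Rightarrow> nat \<Rightarrow> 'a" where
  "qsummand q n k = qfact (q ^ (n - k + 1)) q (2 * k) / qfact (q ^ 2) (q ^ 2) k
                      * q ^ ((n - k) choose 2)"

lemma choose_two_Suc_Suc: "Suc (Suc m) choose 2 = (m choose 2) + 2 * m + 1"
  by (simp add: numeral_2_eq_2)

text \<open>At index 0 both factorials are empty, so only the binomial exponent of \<open>q\<close>
  changes.\<close>

lemma qsummand_Suc_Suc_0: "qsummand q (Suc (Suc m)) 0 = q ^ (2 * m + 1) * qsummand q m 0"
  by (simp add: qsummand_def choose_two_Suc_Suc power_add algebra_simps)

text \<open>The two top indices are treated apart: the term t(m,k+1) is zero on paper, but
  truncation may make \<open>qsummand q m (Suc k)\<close> nonzero. The two sides start their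
  numerators at the same power and carry the same binomial exponent, so only the newly added factors
  have to be compared.\<close>

lemma qsummand_boundary:
  fixes q :: "'a::field"
  assumes "q ^ (2 * k + 2) \<noteq> 1" and "k = m \<or> k = Suc m"
  shows "qsummand q (Suc (Suc m)) (Suc k) = (1 - q ^ (2 * m + 3)) * qsummand q (Suc m) k"
proof -
  have nz: "1 - q ^ 2 * (q ^ 2) ^ k \<noteq> 0"
    using assms(1) by (simp only: power_add power_mult[symmetric] mult.commute) simp
  \<comment> \<open>The two new numerator factors have exponents 2m+2 and 2m+3 if
    \<open>k = m\<close>, and 2m+3 and 2m+4 if \<open>k = Suc m\<close>. Either way one exponent is
    2k+2, and that factor cancels the new denominator factor.\<close>
  have "(1 - q ^ (Suc m - k + 1) * q ^ (2 * k)) * (1 - q ^ (Suc m - k + 1) * q ^ (2 * k + 1))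
          = (1 - q ^ (2 * m + 3)) * (1 - q ^ 2 * (q ^ 2) ^ k)"
    using assms(2) by (auto simp: power_mult[symmetric] power_add[symmetric] numeral_3_eq_3 mult.commute
        simp del: power_Suc)
  then have "qfact (q ^ (Suc m - k + 1)) q (2 * Suc k)
               = qfact (q ^ (Suc m - k + 1)) q (2 * k)
                   * ((1 - q ^ (2 * m + 3)) * (1 - q ^ 2 * (q ^ 2) ^ k))"
    by (simp add: qfact_Suc mult.assoc)
  then show ?thesis
    using nz by (simp add: qsummand_def qfact_Suc[of _ _ k])
qed

lemma qsummand_interior:
  fixes q :: "'a::field"
  assumes "q ^ (2 * k + 2) \<noteq> 1" and m: "m = j + k + 1"
  shows "qsummand q (Suc (Suc m)) (Suc k)
           = q ^ (2 * m + 1) * qsummand q m (Suc k) + (1 - q ^ (2 * m + 3)) * qsummand q (Suc m) k"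
proof -
  \<comment> \<open>\<open>W\<close> is shared by all three numerators: it is that of t(m+1,k),
    gains two factors at the top in t(m+2,k+1), and two at the bottom in t(m,k+1).\<close>
  define W D where "W = qfact (q ^ (j + 3)) q (2 * k)" and "D = qfact (q ^ 2) (q ^ 2) k"
  define x y C where "x = q ^ j" and "y = q ^ k" and "C = q ^ (j choose 2)"
  have nz: "1 - q ^ 2 * y ^ 2 \<noteq> 0"
    using assms(1) by (simp only: y_def power_add power_mult[symmetric] mult.commute) simp
  have D: "qfact (q ^ 2) (q ^ 2) (Suc k) = D * (1 - q ^ 2 * y ^ 2)"
    by (simp add: qfact_Suc D_def y_def power_mult[symmetric] mult.commute)
  have C: "q ^ (Suc (Suc j) choose 2) = C * x ^ 2 * q"
    by (simp add: choose_two_Suc_Suc C_def x_def power_add power_mult[symmetric] mult.commute)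
  have upper: "qfact (q ^ (j + 3)) q (2 * Suc k)
                 = W * (1 - x * y ^ 2 * q ^ 3) * (1 - x * y ^ 2 * q ^ 4)"
    by (simp add: qfact_Suc W_def x_def y_def power_add power_mult[symmetric] mult_ac
        power2_eq_square numeral_eq_Suc)
  have lower: "qfact (q ^ (j + 1)) q (2 * Suc k) = (1 - x * q) * (1 - x * q ^ 2) * W"
    by (simp add: qfact_Suc_shift W_def x_def power_add mult_ac power2_eq_square numeral_eq_Suc)
  have m1: "q ^ (2 * m + 1) = x ^ 2 * y ^ 2 * q ^ 3"
    and m3: "q ^ (2 * m + 3) = x ^ 2 * y ^ 2 * q ^ 5"
    by (simp_all add: m x_def y_def power_add power_mult mult_ac power2_eq_square numeral_eq_Suc
        power_mult_distrib)
  have t1: "qsummand q (Suc (Suc m)) (Suc k)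
              = W * (1 - x * y ^ 2 * q ^ 3) * (1 - x * y ^ 2 * q ^ 4) / (D * (1 - q ^ 2 * y ^ 2))
                  * (C * x ^ 2 * q)"
  proof -
    have e: "Suc (Suc m) - Suc k = Suc (Suc j)" "Suc (Suc j) + 1 = j + 3" by (simp_all add: m)
    show ?thesis unfolding qsummand_def e upper D C ..
  qed
  have t2: "qsummand q (Suc m) k
              = W / D * (C * x ^ 2 * q)"
  proof -
    have e: "Suc m - k = Suc (Suc j)" "Suc (Suc j) + 1 = j + 3" by (simp_all add: m)
    show ?thesis unfolding qsummand_def e W_def[symmetric] D_def[symmetric] C ..
  qed
  have t3: "qsummand q m (Suc k)
              = (1 - x * q) * (1 - x * q ^ 2) * W / (D * (1 - q ^ 2 * y ^ 2)) * C"
  proof -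
    have e: "m - Suc k = j" by (simp add: m)
    show ?thesis unfolding qsummand_def e lower D C_def ..
  qed
  have t2': "W / D = W * (1 - q ^ 2 * y ^ 2) / (D * (1 - q ^ 2 * y ^ 2))"
    using nz by simp
  \<comment> \<open>This is the recurrence with the common factor \<open>E\<close>, defined below,
    removed. Up to the factor x^2 q, both sides expand to 1 - x y^2 q^3 (1 + q) + x^2 y^4
    q^7.\<close>
  have poly: "(1 - x * y ^ 2 * q ^ 3) * (1 - x * y ^ 2 * q ^ 4) * (x ^ 2 * q)
      = x ^ 2 * y ^ 2 * q ^ 3 * ((1 - x * q) * (1 - x * q ^ 2))
        + (1 - x ^ 2 * y ^ 2 * q ^ 5) * (1 - q ^ 2 * y ^ 2) * (x ^ 2 * q)"
    by algebra
  define E where "E = W * C / (D * (1 - q ^ 2 * y ^ 2))"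
  have "qsummand q (Suc (Suc m)) (Suc k)
          = (1 - x * y ^ 2 * q ^ 3) * (1 - x * y ^ 2 * q ^ 4) * (x ^ 2 * q) * E"
    by (simp add: t1 E_def mult_ac)
  also have "\<dots> = x ^ 2 * y ^ 2 * q ^ 3 * ((1 - x * q) * (1 - x * q ^ 2) * E)
        + (1 - x ^ 2 * y ^ 2 * q ^ 5) * ((1 - q ^ 2 * y ^ 2) * (x ^ 2 * q) * E)"
    unfolding poly by (simp add: distrib_right mult.assoc)
  also have "(1 - x * q) * (1 - x * q ^ 2) * E = qsummand q m (Suc k)"
    by (simp add: t3 E_def mult_ac)
  also have "(1 - q ^ 2 * y ^ 2) * (x ^ 2 * q) * E = qsummand q (Suc m) k"
    unfolding t2 t2' by (simp add: E_def mult_ac)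
  finally show ?thesis
    unfolding m1 m3 .
qed

text \<open>Summing the termwise relations gives the recurrence; that \<open>q\<close> is no root of
  unity keeps the new denominator factors 1 - q^(2k+2) nonzero.\<close>

lemma sum_qsummand_recurrence:
  fixes q :: "'a::field"
  assumes nontorsion: "\<And>i. i > 0 \<Longrightarrow> q ^ i \<noteq> 1"
  shows "(\<Sum>k\<le>m + 2. qsummand q (m + 2) k)
           = q ^ (2 * m + 1) * (\<Sum>k\<le>m. qsummand q m k)
             + (1 - q ^ (2 * m + 3)) * (\<Sum>k\<le>m + 1. qsummand q (m + 1) k)"
proof -
  let ?t = "qsummand q" and ?a = "q ^ (2 * m + 1)" and ?b = "1 - q ^ (2 * m + 3)"
  have boundary: "?t (Suc (Suc m)) (Suc k) = ?b * ?t (Suc m) k" if "k = m \<or> k = Suc m" for k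
    using qsummand_boundary[of q k m] nontorsion[of "2 * k + 2"] that by simp
  have interior: "?t (Suc (Suc m)) (Suc k) = ?a * ?t m (Suc k) + ?b * ?t (Suc m) k"
    if "k < m" for k
    using qsummand_interior[of q k m "m - k - 1"] nontorsion[of "2 * k + 2"] that by simp
  \<comment> \<open>Index 0 and the last two indices are split off, leaving exactly the range where
    the interior relation applies.\<close>
  have "(\<Sum>k\<le>Suc (Suc m). ?t (Suc (Suc m)) k)
          = ?t (Suc (Suc m)) 0 + (\<Sum>k<m. ?t (Suc (Suc m)) (Suc k))
            + ?t (Suc (Suc m)) (Suc m) + ?t (Suc (Suc m)) (Suc (Suc m))"
    by (subst sum.atMost_Suc_shift) (simp add: lessThan_Suc_atMost[symmetric] add_ac)
  also have "\<dots> = ?a * (?t m 0 + (\<Sum>k<m. ?t m (Suc k)))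
      + ?b * ((\<Sum>k<m. ?t (Suc m) k) + ?t (Suc m) m + ?t (Suc m) (Suc m))"
    by (simp add: boundary interior qsummand_Suc_Suc_0 sum.distrib sum_distrib_left[symmetric]
        distrib_left add_ac)
  also have "?t m 0 + (\<Sum>k<m. ?t m (Suc k)) = (\<Sum>k\<le>m. ?t m k)"
    by (simp add: sum.atMost_shift)
  also have "(\<Sum>k<m. ?t (Suc m) k) + ?t (Suc m) m + ?t (Suc m) (Suc m)
               = (\<Sum>k\<le>Suc m. ?t (Suc m) k)"
    by (simp add: lessThan_Suc_atMost[symmetric])
  finally show ?thesis by simp
qed

lemma qvar_power: "qvar ^ i = to_fract (monom (1 :: 'a::field) i)"
  by (induction i) (simp_all add: qvar_def to_fract_mult[symmetric] monom_altdef one_pCons[symmetric])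

text \<open>Powers of the indeterminate are monomials, and a monomial of positive degree is not
  constant.\<close>

lemma qvar_power_neq_1: "i > 0 \<Longrightarrow> qvar ^ i \<noteq> (1 :: 'a::field poly fract)"
proof
  assume "i > 0" and "qvar ^ i = (1 :: 'a poly fract)"
  then have "monom (1 :: 'a) i = 1"
    by (simp add: qvar_power to_fract_eq_iff flip: to_fract_1)
  then have "degree (monom (1 :: 'a) i) = degree (1 :: 'a poly)" by simp
  with \<open>i > 0\<close> show False by (simp add: degree_monom_eq)
qed

theorem corollary3p3:
  fixes n :: nat
  assumes "n \<ge> 2"
  shows "F n + (qvar ^ (2 * n - 1) - 1) * F (n - 1) - qvar ^ (2 * n - 3) * F (n - 2)
           = (0 :: 'a::field poly fract)"
proof -
  obtain m where n: "n = m + 2"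
    using assms by (metis add.commute le_Suc_ex)
  have F: "F i = (\<Sum>k\<le>i. qsummand (qvar :: 'a poly fract) i k)" for i
    by (simp add: F_def qsummand_def atMost_atLeast0)
  have e: "2 * n - 1 = 2 * m + 3" "2 * n - 3 = 2 * m + 1" "n - 1 = m + 1" "n - 2 = m"
    by (simp_all add: n)
  show ?thesis
    using sum_qsummand_recurrence[OF qvar_power_neq_1[where 'a = 'a], of m]
    unfolding F e unfolding n by (simp add: left_diff_distrib)
qed

end
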